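(* Let $\ell:[0,\infty)\to(0,\infty)$ be non-decreasing, positive and locally Lipschitz, and assume that $\psi_2(x)=\frac{x^2}{\ell(2x)}$ is strictly increasing on $[0,\infty)$. Then for every $\Delta\ge0$ there is a finite number $\bar T(\ell,\Delta)\ge0$, depending only on $\ell$ and $\Delta$, such that the following holds. Let $f:\mathbb{R}^d\to\mathbb{R}\cup\{\infty\}$ be $\ell$-smooth and convex, attaining its minimum at $x_*\in\mathbb{R}^d$, let $x_0\in\mathcal{X}$ with $f(x_0)-f(x_* )=\Delta$, put $R:=\|x_0-x_*\|$, $M_0:=\|\nabla f(x_0)\|$, and let $\{x_k\}_{k\ge0}$ be generated by $$x_{k+1}=x_k-\gamma_k\nabla f(x_k),\qquad \gamma_k=\int_0^1\frac{dv}{\ell(\|\nabla f(x_k)\|+\|\nabla f(x_k)\|v)}.$$ Then for every $\varepsilon>0$ and every integer $T\ge0$ with $$T\ge\frac{\ell(0)R^2}{\varepsilon}+\min\left\{\bar T(\ell,\Delta),\frac{\ell(2M_0)R^2}{2\varepsilon}\right\}$$ one has $f(x_T)-f(x_* )\le\varepsilon$. (In particular $\bar T(\ell,\Delta)$ does not depend on $\varepsilon$.)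
   Context: Norms are Euclidean for vectors and spectral for matrices. For $f:\mathbb{R}^d\to\mathbb{R}\cup\{\infty\}$ put $\mathcal{X}=\{x\in\mathbb{R}^d: f(x)<\infty\}$, assumed to be open and convex. $f$ is $\ell$-smooth if $f$ is twice differentiable on $\mathcal{X}$, $f$ is continuous on the closure of $\mathcal{X}$ (as a map into $\mathbb{R}\cup\{\infty\}$), and $\|\nabla^2f(x)\|\le\ell(\|\nabla f(x)\|)$ for all $x\in\mathcal{X}$. (The iteration is well defined: the iterates stay in $\mathcal{X}$.) *)

theory Defs
  imports "HOL-Analysis.Analysis"
begin

text \<open>
  The bound in the theorem is uniform in the dimension $d$, so $d$ must be quantified inside
  the formula and cannot be the cardinality of an index type. All the Euclidean spaces
  are therefore realised as the subspaces \<open>Rn d\<close> of a single inner product space, the finitely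
  supported real sequences: \<open>Rn d\<close> consists of the sequences vanishing from index \<open>d\<close> on, with
  the Euclidean inner product, norm and topology.
\<close>

typedef fin_seq = "{x :: nat \<Rightarrow> real. finite {i. x i \<noteq> 0}}"
  morphisms coord Abs_fin_seq
  by (rule exI[of _ "\<lambda>_. 0"]) simp

lemma finite_supp: "finite {i. coord x i \<noteq> 0}"
  using coord[of x] by simp

lemma fin_seq_eqI: "(\<And>i. coord x i = coord y i) \<Longrightarrow> x = y"
  by (metis coord_inject ext)

lemma coord_Abs: "finite {i. g i \<noteq> 0} \<Longrightarrow> coord (Abs_fin_seq g) = g"
  by (simp add: Abs_fin_seq_inverse)

instantiation fin_seq :: real_vector
begin

definition zero_fin_seq :: fin_seq
  where "0 = Abs_fin_seq (\<lambda>_. 0)"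

definition plus_fin_seq :: "fin_seq \<Rightarrow> fin_seq \<Rightarrow> fin_seq"
  where "x + y = Abs_fin_seq (\<lambda>i. coord x i + coord y i)"

definition uminus_fin_seq :: "fin_seq \<Rightarrow> fin_seq"
  where "- x = Abs_fin_seq (\<lambda>i. - coord x i)"

definition minus_fin_seq :: "fin_seq \<Rightarrow> fin_seq \<Rightarrow> fin_seq"
  where "x - y = Abs_fin_seq (\<lambda>i. coord x i - coord y i)"

definition scaleR_fin_seq :: "real \<Rightarrow> fin_seq \<Rightarrow> fin_seq"
  where "r *\<^sub>R x = Abs_fin_seq (\<lambda>i. r * coord x i)"

lemma coord_zero [simp]: "coord 0 i = 0"
  by (simp add: zero_fin_seq_def coord_Abs)

lemma coord_plus [simp]: "coord (x + y) i = coord x i + coord y i"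
proof -
  have "finite {i. coord x i + coord y i \<noteq> 0}"
    by (rule finite_subset[OF _ finite_UnI[OF finite_supp[of x] finite_supp[of y]]]) auto
  then show ?thesis by (simp add: plus_fin_seq_def coord_Abs)
qed

lemma coord_uminus [simp]: "coord (- x) i = - coord x i"
  using finite_supp[of x] by (simp add: uminus_fin_seq_def coord_Abs)

lemma coord_minus [simp]: "coord (x - y) i = coord x i - coord y i"
proof -
  have "finite {i. coord x i - coord y i \<noteq> 0}"
    by (rule finite_subset[OF _ finite_UnI[OF finite_supp[of x] finite_supp[of y]]]) auto
  then show ?thesis by (simp add: minus_fin_seq_def coord_Abs)
qed

lemma coord_scaleR [simp]: "coord (r *\<^sub>R x) i = r * coord x i"
proof -
  have "finite {i. r * coord x i \<noteq> 0}"
    by (rule finite_subset[OF _ finite_supp[of x]]) auto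
  then show ?thesis by (simp add: scaleR_fin_seq_def coord_Abs)
qed

instance
  by standard (auto intro!: fin_seq_eqI simp: algebra_simps)

end

instantiation fin_seq :: real_inner
begin

definition inner_fin_seq :: "fin_seq \<Rightarrow> fin_seq \<Rightarrow> real"
  where "x \<bullet> y = (\<Sum>i | coord x i \<noteq> 0. coord x i * coord y i)"

definition norm_fin_seq :: "fin_seq \<Rightarrow> real"
  where "norm_fin_seq x = sqrt (x \<bullet> x)"

definition dist_fin_seq :: "fin_seq \<Rightarrow> fin_seq \<Rightarrow> real"
  where "dist_fin_seq x y = norm (x - y)"

definition sgn_fin_seq :: "fin_seq \<Rightarrow> fin_seq"
  where "sgn_fin_seq x = x /\<^sub>R norm x"

definition uniformity_fin_seq :: "(fin_seq \<times> fin_seq) filter"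
  where "uniformity_fin_seq = (INF e\<in>{0<..}. principal {(x, y). dist x y < e})"

definition open_fin_seq :: "fin_seq set \<Rightarrow> bool"
  where "open_fin_seq U = (\<forall>x\<in>U. eventually (\<lambda>(x', y). x' = x \<longrightarrow> y \<in> U) uniformity)"

lemma inner_fin_seq_superset:
  assumes "finite S" "{i. coord x i \<noteq> 0} \<subseteq> S"
  shows "x \<bullet> y = (\<Sum>i\<in>S. coord x i * coord y i)"
  unfolding inner_fin_seq_def using assms by (intro sum.mono_neutral_left) auto

instance
proof
  fix x y z :: fin_seq and r :: real
  let ?S = "{i. coord x i \<noteq> 0} \<union> {i. coord y i \<noteq> 0}"
  have fin: "finite ?S" by (simp add: finite_supp)
  show "x \<bullet> y = y \<bullet> x"
    using inner_fin_seq_superset[OF fin, of x y] inner_fin_seq_superset[OF fin, of y x]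
    by (simp add: mult.commute)
  have "{i. coord (x + y) i \<noteq> 0} \<subseteq> ?S" by auto
  then show "(x + y) \<bullet> z = x \<bullet> z + y \<bullet> z"
    using inner_fin_seq_superset[OF fin, of x z] inner_fin_seq_superset[OF fin, of y z]
      inner_fin_seq_superset[OF fin, of "x + y" z]
    by (simp add: distrib_right sum.distrib)
  have "{i. coord (r *\<^sub>R x) i \<noteq> 0} \<subseteq> ?S" by auto
  then show "(r *\<^sub>R x) \<bullet> y = r * (x \<bullet> y)"
    using inner_fin_seq_superset[OF fin, of x y] inner_fin_seq_superset[OF fin, of "r *\<^sub>R x" y]
    by (simp add: sum_distrib_left mult.assoc)
  show "0 \<le> x \<bullet> x"
    by (auto simp: inner_fin_seq_def intro!: sum_nonneg)
  show "(x \<bullet> x = 0) = (x = 0)"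
  proof
    assume "x \<bullet> x = 0"
    then have "\<forall>i\<in>{i. coord x i \<noteq> 0}. coord x i * coord x i = 0"
      unfolding inner_fin_seq_def by (subst (asm) sum_nonneg_eq_0_iff) (auto simp: finite_supp)
    then show "x = 0" by (intro fin_seq_eqI) auto
  qed (simp add: inner_fin_seq_def)
qed (simp_all add: norm_fin_seq_def dist_fin_seq_def sgn_fin_seq_def uniformity_fin_seq_def
      open_fin_seq_def)

end

definition Rn :: "nat \<Rightarrow> fin_seq set"
  where "Rn d = {x. \<forall>i\<ge>d. coord x i = 0}"

definition unit_vec :: "nat \<Rightarrow> fin_seq"
  where "unit_vec i = Abs_fin_seq (\<lambda>j. if j = i then 1 else 0)"

text \<open>The orthogonal projection onto \<open>Rn d\<close>.\<close>

definition proj_Rn :: "nat \<Rightarrow> fin_seq \<Rightarrow> fin_seq"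
  where "proj_Rn d x = (\<Sum>i<d. coord x i *\<^sub>R unit_vec i)"

lemma coord_unit_vec [simp]: "coord (unit_vec i) j = (if j = i then 1 else 0)"
  by (simp add: unit_vec_def coord_Abs)

lemma coord_sum: "coord (\<Sum>i\<in>A. g i) j = (\<Sum>i\<in>A. coord (g i) j)"
  by (induction A rule: infinite_finite_induct) auto

lemma coord_proj_Rn [simp]: "coord (proj_Rn d x) i = (if i < d then coord x i else 0)"
  by (simp add: proj_Rn_def coord_sum if_distrib[of "(*) _"] sum.delta cong: if_cong)

lemma norm_Rn: "x \<in> Rn d \<Longrightarrow> norm x = sqrt (\<Sum>i<d. (coord x i)\<^sup>2)"
  by (subst norm_eq_sqrt_inner, subst inner_fin_seq_superset[of "{..<d}"])
    (auto simp: Rn_def power2_eq_square not_less intro: leI)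

lemma subspace_Rn: "subspace (Rn d)"
  by (auto simp: subspace_def Rn_def)

lemma proj_Rn_eq: "x \<in> Rn d \<Longrightarrow> proj_Rn d x = x"
  by (rule fin_seq_eqI) (auto simp: Rn_def)

lemma closed_Rn: "closed (Rn d)"
proof -
  have "x \<bullet> unit_vec i = coord x i" for x i
    by (subst inner_commute, subst inner_fin_seq_superset[of "{i}"]) (auto split: if_splits)
  then have "Rn d = (\<Inter>i\<in>{d..}. {x. x \<bullet> unit_vec i = 0})"
    by (auto simp: Rn_def)
  then show ?thesis
    by (auto intro!: closed_INT closed_Collect_eq continuous_intros)
qed

text \<open>
  A function $\mathbb{R}^d \to \mathbb{R}\cup\{\infty\}$ is represented by a map \<open>f\<close> into the
  extended reals, of which only the values on \<open>Rn d\<close> are ever used; it is to be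
  different from \<open>-\<infinity>\<close> there.
\<close>

definition fin_dom :: "nat \<Rightarrow> (fin_seq \<Rightarrow> ereal) \<Rightarrow> fin_seq set"
  where "fin_dom d f = {x \<in> Rn d. f x < \<infinity>}"

text \<open>
  Derivatives are taken within the domain, which will be open in \<open>Rn d\<close>.
  The condition \<open>g \<in> Rn d\<close> makes the gradient unique; the lemma \<open>grad_has_derivative\<close> below
  justifies the description.
\<close>

definition grad :: "nat \<Rightarrow> (fin_seq \<Rightarrow> ereal) \<Rightarrow> fin_seq \<Rightarrow> fin_seq"
  where "grad d f x = (THE g. g \<in> Rn d \<and>
     ((\<lambda>y. real_of_ereal (f y)) has_derivative (\<lambda>h. g \<bullet> h)) (at x within fin_dom d f))"

lemma has_derivative_unique_on_Rn:
  assumes op: "openin (top_of_set (Rn d)) S" and "x \<in> S"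
   and A: "(F has_derivative A) (at x within S)" and B: "(F has_derivative B) (at x within S)" and h: "h \<in> Rn d"
 shows "A h = (B h :: 'b::real_normed_vector)"
proof -
  obtain e where e: "e > 0" "ball x e \<inter> Rn d \<subseteq> S" using op \<open>x\<in>S\<close> by (meson openin_contains_ball)
  have xR: "x \<in> Rn d" using op \<open>x\<in>S\<close> openin_imp_subset by auto
  define k where "k t = x + t *\<^sub>R h" for t :: real
  define d' where "d' = e / (norm h + 1)"
  have d': "d' > 0" using e by (simp add: d'_def add_nonneg_pos)
  have sub: "k ` {-d'<..<d'} \<subseteq> S"
  proof clarify
    fix t assume t: "t \<in> {-d'<..<d'}"
    have "\<bar>t\<bar> * norm h \<le> \<bar>t\<bar> * (norm h + 1)" by (simp add: mult_left_mono)
    also have "\<dots> < e" using t by (simp add: d'_def pos_less_divide_eq[symmetric] abs_less_iff add_nonneg_pos)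
    finally have "k t \<in> ball x e" by (simp add: k_def dist_norm)
    moreover have "k t \<in> Rn d" using xR h by (simp add: k_def Rn_def)
    ultimately show "k t \<in> S" using e by blast
  qed
  have kd: "(k has_derivative (\<lambda>t. t *\<^sub>R h)) (at 0)"
    unfolding k_def by (auto intro!: derivative_eq_intros)
  have k0: "k 0 = x" by (simp add: k_def)
  have gen: "((F \<circ> k) has_derivative (C \<circ> (\<lambda>t. t *\<^sub>R h))) (at 0)" if "(F has_derivative C) (at x within S)" for C
  proof -
    have "((F \<circ> k) has_derivative (C \<circ> (\<lambda>t. t *\<^sub>R h))) (at 0 within {-d'<..<d'})"
      using diff_chain_within[OF has_derivative_at_withinI[OF kd]]
       has_derivative_subset[OF that sub] k0 by metis
    then show ?thesis using d' by (metis at_within_open open_greaterThanLessThan greaterThanLessThan_iff neg_less_0_iff_less)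
  qed
  have "A \<circ> (\<lambda>t. t *\<^sub>R h) = B \<circ> (\<lambda>t. t *\<^sub>R h)"
    using gen[OF A] gen[OF B] has_derivative_unique by blast
  then show ?thesis by (metis comp_apply scaleR_one)
qed

lemma unit_inner: "unit_vec i \<bullet> x = coord x i"
  by (subst inner_fin_seq_superset[of "{i}"]) (auto split: if_splits)

lemma grad_has_derivative:
  assumes op: "openin (top_of_set (Rn d)) (fin_dom d f)" and x: "x \<in> fin_dom d f"
   and D: "(\<lambda>y. real_of_ereal (f y)) differentiable (at x within fin_dom d f)"
  shows "grad d f x \<in> Rn d" "((\<lambda>y. real_of_ereal (f y)) has_derivative (\<lambda>h. grad d f x \<bullet> h)) (at x within fin_dom d f)"
proof -
  let ?F = "\<lambda>y. real_of_ereal (f y)" let ?X = "fin_dom d f"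
  obtain A where A: "(?F has_derivative A) (at x within ?X)" using D differentiable_def by blast
  define g where "g = (\<Sum>i<d. A (unit_vec i) *\<^sub>R unit_vec i)"
  have gR: "g \<in> Rn d" by (auto simp: g_def Rn_def coord_sum intro!: sum.neutral)
  interpret A: bounded_linear A using A has_derivative_bounded_linear by blast
  have Ag: "A h = g \<bullet> h" if "h \<in> Rn d" for h
  proof -
    have "A h = A (proj_Rn d h)" using that by (simp add: proj_Rn_eq)
    also have "\<dots> = g \<bullet> h"
      by (simp add: proj_Rn_def A.sum A.scaleR g_def inner_sum_left unit_inner mult.commute)
    finally show ?thesis .
  qed
  have "(?F has_derivative (\<lambda>h. g \<bullet> h)) (at x within ?X)"
    using A unfolding has_derivative_within
  proof (elim conjE, intro conjI)
    show "bounded_linear ((\<bullet>) g)" by (rule bounded_linear_inner_right)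
    assume L: "((\<lambda>y. (1 / norm (y - x)) *\<^sub>R (?F y - (?F x + A (y - x)))) \<longlongrightarrow> 0) (at x within ?X)"
    show "((\<lambda>y. (1 / norm (y - x)) *\<^sub>R (?F y - (?F x + g \<bullet> (y - x)))) \<longlongrightarrow> 0) (at x within ?X)"
      by (rule Lim_transform_within[OF L, of 1])
        (use x Ag in \<open>auto simp: fin_dom_def Rn_def\<close>)
  qed
  then have P: "g \<in> Rn d \<and> (?F has_derivative (\<lambda>h. g \<bullet> h)) (at x within ?X)" using gR by blast
  have uniq: "g' = g" if "g' \<in> Rn d \<and> (?F has_derivative (\<lambda>h. g' \<bullet> h)) (at x within ?X)" for g'
  proof -
    have "g' \<bullet> (g'-g) = g \<bullet> (g'-g)" by (rule has_derivative_unique_on_Rn[OF op x]) (use that P in \<open>auto simp: Rn_def\<close>)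
    then have "(g'-g) \<bullet> (g'-g) = 0" by (simp add: inner_diff_left)
    then show ?thesis by simp
  qed
  have "grad d f x = g" unfolding grad_def by (rule the_equality) (use P uniq in blast)+
  then show "grad d f x \<in> Rn d" "(?F has_derivative (\<lambda>h. grad d f x \<bullet> h)) (at x within ?X)" using P by auto
qed

text \<open>
  The derivative of the gradient is determined on \<open>Rn d\<close> only; composing with the
  projection extends it by zero to the orthogonal complement, which leaves its operator norm on
  \<open>Rn d\<close> unchanged. Thus \<open>onorm (hess d f x)\<close> is the spectral norm of the Hessian matrix.
\<close>

definition hess :: "nat \<Rightarrow> (fin_seq \<Rightarrow> ereal) \<Rightarrow> fin_seq \<Rightarrow> fin_seq \<Rightarrow> fin_seq"
  where "hess d f x h = frechet_derivative (grad d f) (at x within fin_dom d f) (proj_Rn d h)"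

definition l_smooth :: "nat \<Rightarrow> (real \<Rightarrow> real) \<Rightarrow> (fin_seq \<Rightarrow> ereal) \<Rightarrow> bool"
  where "l_smooth d l f \<longleftrightarrow>
     (\<lambda>y. real_of_ereal (f y)) differentiable_on fin_dom d f \<and>
     grad d f differentiable_on fin_dom d f \<and>
     continuous_on (closure (fin_dom d f)) f \<and>
     (\<forall>x\<in>fin_dom d f. onorm (hess d f x) \<le> l (norm (grad d f x)))"

definition step_size :: "(real \<Rightarrow> real) \<Rightarrow> real \<Rightarrow> real"
  where "step_size l m = integral {0..1} (\<lambda>v. 1 / l (m + m * v))"

end

theory Submission
  imports Defs
begin

text \<open>
  Let \<open>m\<close> be the gradient norm at the current point and \<open>\<gamma>\<close> the step size there. Moving away from
  that point at unit speed, the gradient changes at a rate of at most \<open>l (m + c)\<close> once it has changed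
  by \<open>c\<close>. The time it needs to change by \<open>c\<close> is therefore at least the integral of
  \<open>1 / l (m + v)\<close> over \<open>v \<in> [0, c]\<close>, and for \<open>c = m\<close> this integral is \<open>\<gamma> * m\<close>, the length of the
  step. As the integral is concave in \<open>c\<close>, the gradient differs from its initial value by at most
  \<open>r / \<gamma>\<close> at distance \<open>r \<le> \<gamma> * m\<close> (\<open>gradient_lipschitz_at\<close>): seen from its centre, the ball of
  radius \<open>\<gamma> * m\<close> looks as if \<open>f\<close> were smooth with constant \<open>1 / \<gamma>\<close>. In particular \<open>f\<close> lies
  below a quadratic on the part of the ball where it is finite, and since it tends to infinity at the
  boundary of its domain, the whole ball lies in the domain (\<open>ball_in_domain\<close>).

  From here on the classical analysis of gradient descent with step \<open>1 / L\<close> applies at every single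
  step: a step decreases \<open>f\<close> by at least \<open>\<gamma> / 2 * m\<^sup>2\<close>, and with convexity it does not increase
  the gradient norm and decreases the squared distance to the minimiser by at least
  \<open>2 * \<gamma>\<close> times the new gap. Summing gives a gap of at most \<open>R\<^sup>2\<close> divided by twice the sum of the
  step sizes (\<open>total_step_bound\<close>), so it remains to bound that sum from below.

  There are two ways to do so. As gradient norms do not increase, all step sizes are at least
  \<open>1 / l (2 * m\<^sub>0)\<close>, where \<open>m\<^sub>0\<close> is the initial gradient norm. Alternatively, continuity of \<open>l\<close>
  provides a threshold \<open>M > 0\<close> with \<open>l (2 * M) \<le> 2 * l 0\<close>. Steps at gradient norm at most \<open>M\<close>
  have size at least \<open>1 / (2 * l 0)\<close>. All other steps decrease \<open>f\<close> by at least
  \<open>M\<^sup>2 / (2 * l (2 * M))\<close>, by monotonicity of \<open>s\<^sup>2 / l (2 * s)\<close>, so that their number is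
  at most \<open>2 * \<Delta> * l (2 * M) / M\<^sup>2\<close>, whatever \<open>\<epsilon>\<close> and the dimension are.
\<close>

section \<open>The time a gradient needs to grow\<close>

text \<open>
  Up to the factor \<open>m\<close>, this is the time that a solution of \<open>u' = l u\<close> needs to grow from \<open>m\<close> to
  \<open>m + m * s\<close>. Growth is measured in multiples of \<open>m\<close> so that doubling corresponds to \<open>s = 1\<close> and
  yields the step size itself.
\<close>

definition growth_time :: "(real \<Rightarrow> real) \<Rightarrow> real \<Rightarrow> real \<Rightarrow> real"
  where "growth_time l m s = integral {0..s} (\<lambda>v. 1 / l (m + m * v))"

lemma step_size_eq_growth_time: "step_size l m = growth_time l m 1"
  by (simp add: step_size_def growth_time_def)

lemma continuous_on_if_locally_lipschitz:
  fixes l :: "real \<Rightarrow> real"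
  assumes "\<forall>s\<ge>0. \<exists>u>0. \<exists>L. L-lipschitz_on (cball s u \<inter> {0..}) l"
  shows "continuous_on {0..} l"
proof (rule continuous_on_eq_continuous_within[THEN iffD2], rule ballI)
  fix s :: real assume s: "s \<in> {0..}"
  then obtain u L where u: "u > 0" "L-lipschitz_on (cball s u \<inter> {0..}) l"
    using assms by auto
  have "continuous (at s within cball s u \<inter> {0..}) l"
    using lipschitz_on_continuous_within[OF u(2)] s u(1) by auto
  moreover have "at s within cball s u \<inter> {0..} = at s within {0..}"
    using u(1) by (intro at_within_nhd[of s "ball s u"]) auto
  ultimately show "continuous (at s within {0..}) l" by simp
qed

locale growth_bound =
  fixes l :: "real \<Rightarrow> real"
  assumes l_mono: "mono_on {0..} l"
    and l_pos: "s \<ge> 0 \<Longrightarrow> l s > 0"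
    and l_cont: "continuous_on {0..} l"
begin

lemma l_le: "0 \<le> s \<Longrightarrow> s \<le> t \<Longrightarrow> l s \<le> l t"
  using l_mono by (auto simp: mono_on_def)

lemma growth_time_has_derivative:
  assumes "m \<ge> 0" "s \<in> {0..b}"
  shows "(growth_time l m has_real_derivative 1 / l (m + m * s)) (at s within {0..b})"
proof -
  have "continuous_on {0..b} (\<lambda>v. 1 / l (m + m * v))"
  proof (intro continuous_on_divide continuous_on_const continuous_on_compose2[OF l_cont])
    show "\<forall>v\<in>{0..b}. l (m + m * v) \<noteq> 0"
      using assms(1) l_pos by (metis atLeastAtMost_iff add_nonneg_nonneg mult_nonneg_nonneg less_irrefl)
  qed (use assms in \<open>auto intro!: continuous_intros\<close>)
  then show ?thesis
    unfolding growth_time_def by (rule integral_has_real_derivative) (use assms in simp)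
qed

lemma growth_time_mean_value:
  assumes "m \<ge> 0" "0 \<le> a" "a \<le> b"
  obtains v where "a \<le> v" "v \<le> b" "growth_time l m b - growth_time l m a = (b - a) / l (m + m * v)"
proof -
  have "(growth_time l m has_derivative (*) (1 / l (m + m * s))) (at s within {a..b})"
    if "a \<le> s" "s \<le> b" for s
    using growth_time_has_derivative[of m s b] that assms
    by (auto simp: has_field_derivative_def intro: has_derivative_subset[of _ _ _ "{0..b}"])
  from mvt_very_simple[OF assms(3) this] obtain v
    where "v \<in> {a..b}" "growth_time l m b - growth_time l m a = 1 / l (m + m * v) * (b - a)"
    by blast
  then show ?thesis by (intro that[of v]) auto
qed

lemma growth_time_0 [simp]: "growth_time l m 0 = 0"
  by (simp add: growth_time_def)

lemma growth_time_strict_mono: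
  assumes "m \<ge> 0" "0 \<le> a" "a < b"
  shows "growth_time l m a < growth_time l m b"
proof -
  obtain v where v: "a \<le> v" "v \<le> b" "growth_time l m b - growth_time l m a = (b - a) / l (m + m * v)"
    using growth_time_mean_value[of m a b] assms by auto
  have "l (m + m * v) > 0" using v assms by (intro l_pos) auto
  then have "(b - a) / l (m + m * v) > 0" using assms by simp
  then show ?thesis using v(3) by linarith
qed

text \<open>
  Concavity of the growth time: its derivative, evaluated at a point between \<open>0\<close> and \<open>s\<close>,
  is at least its derivative at a point between \<open>s\<close> and \<open>1\<close>.
\<close>

lemma growth_time_above_chord:
  assumes "m \<ge> 0" "0 \<le> s" "s \<le> 1"
  shows "s * growth_time l m 1 \<le> growth_time l m s"
proof -
  obtain v where v: "0 \<le> v" "v \<le> s" "growth_time l m s = s / l (m + m * v)"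
    using growth_time_mean_value[of m 0 s] assms by auto
  obtain w where w: "s \<le> w" "w \<le> 1"
    "growth_time l m 1 - growth_time l m s = (1 - s) / l (m + m * w)"
    using growth_time_mean_value[of m s 1] assms by auto
  have lv: "0 < l (m + m * v)" using v assms by (intro l_pos) auto
  have lvw: "l (m + m * v) \<le> l (m + m * w)"
    using v w assms by (intro l_le) (auto intro!: mult_left_mono)
  have "(1 - s) / l (m + m * w) \<le> (1 - s) / l (m + m * v)"
    using lv lvw assms by (intro divide_left_mono) auto
  then have "s * ((1 - s) / l (m + m * w)) \<le> s * ((1 - s) / l (m + m * v))"
    using assms by (intro mult_left_mono) auto
  also have "\<dots> = (1 - s) * (s / l (m + m * v))" by simp
  finally have "s * (growth_time l m 1 - growth_time l m s) \<le> (1 - s) * growth_time l m s"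
    using v(3) w(3) by simp
  then show ?thesis by (simp add: algebra_simps)
qed

lemma step_size_ge:
  assumes "m \<ge> 0" shows "1 / l (2 * m) \<le> step_size l m" "0 < step_size l m"
proof -
  obtain v where v: "0 \<le> v" "v \<le> 1" "growth_time l m 1 - growth_time l m 0 = (1 - 0) / l (m + m * v)"
    by (rule growth_time_mean_value[of m 0 1]) (use assms in auto)
  have eq: "step_size l m = 1 / l (m + m * v)"
    using v(3) by (simp add: step_size_eq_growth_time)
  have p: "0 < l (m + m * v)" using v assms by (intro l_pos) auto
  have "m * v \<le> m" using v assms mult_left_le by blast
  then have "l (m + m * v) \<le> l (2 * m)" using v assms by (intro l_le) auto
  then show "1 / l (2 * m) \<le> step_size l m"
    unfolding eq using p by (intro frac_le) auto
  show "0 < step_size l m"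
    unfolding eq using p by simp
qed

end

section \<open>Smoothness with a gradient-dependent Hessian bound\<close>

text \<open>
  The map \<open>D y\<close> stands for the Hessian at \<open>y\<close>. Closedness of the sublevel sets in the whole space
  encodes that \<open>F\<close>, extended by infinity outside \<open>X\<close>, is lower semicontinuous and hence blows up
  at the boundary of \<open>X\<close> relative to \<open>S\<close>.
\<close>

locale generalized_smooth = growth_bound +
  fixes S X :: "'a::real_inner set" and F :: "'a \<Rightarrow> real" and g :: "'a \<Rightarrow> 'a"
    and D :: "'a \<Rightarrow> 'a \<Rightarrow> 'a"
  assumes subspace_S: "subspace S"
    and open_X: "openin (top_of_set S) X"
    and convex_X: "convex X"
    and closed_sublevel: "closed {y \<in> X. F y \<le> c}"
    and gradient_in_S: "y \<in> X \<Longrightarrow> g y \<in> S"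
    and gradient: "y \<in> X \<Longrightarrow> (F has_derivative (\<lambda>h. g y \<bullet> h)) (at y within X)"
    and hessian: "y \<in> X \<Longrightarrow> (g has_derivative D y) (at y within X)"
    and hessian_bound: "y \<in> X \<Longrightarrow> h \<in> S \<Longrightarrow> norm (D y h) \<le> l (norm (g y)) * norm h"
begin

lemma X_subset_S: "X \<subseteq> S"
  using open_X openin_imp_subset by auto

lemma segment_in_X:
  assumes "x \<in> X" "x + h \<in> X" "0 \<le> t" "t \<le> 1"
  shows "x + t *\<^sub>R h \<in> X"
proof -
  have "(1 - t) *\<^sub>R x + t *\<^sub>R (x + h) \<in> X"
    using convex_X assms by (intro convexD) auto
  then show ?thesis by (simp add: algebra_simps)
qed

lemma along_line:
  assumes "(\<phi> has_derivative \<phi>') (at (x + t *\<^sub>R h) within X)" "\<And>t. t \<in> I \<Longrightarrow> x + t *\<^sub>R h \<in> X"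
  shows "((\<lambda>t. \<phi> (x + t *\<^sub>R h)) has_derivative (\<lambda>s. \<phi>' (s *\<^sub>R h))) (at t within I)"
proof -
  have "((\<lambda>t. x + t *\<^sub>R h) has_derivative (\<lambda>s. s *\<^sub>R h)) (at t within I)"
    by (auto intro!: derivative_eq_intros)
  moreover have "(\<phi> has_derivative \<phi>') (at (x + t *\<^sub>R h) within (\<lambda>t. x + t *\<^sub>R h) ` I)"
    using assms by (auto intro: has_derivative_subset)
  ultimately show ?thesis by (rule has_derivative_in_compose)
qed

text \<open>
  The change \<open>w\<close> of the gradient along the segment satisfies \<open>norm w' \<le> l (m + norm w) * norm h\<close>
  by the Hessian bound, so the growth time of \<open>norm w\<close> increases at rate at most \<open>norm h / m\<close>.
  Since \<open>norm w\<close> need not be differentiable where it vanishes, the argument is carried out for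
  \<open>sqrt (w \<bullet> w + \<delta>\<^sup>2)\<close>, whose derivative is bounded by \<open>norm w'\<close> as well, with \<open>\<delta>\<close> tending to \<open>0\<close>.
\<close>

lemma growth_time_gradient_change:
  assumes x: "x \<in> X" and h: "h \<in> S" and xh: "x + h \<in> X" and m: "norm (g x) > 0"
  shows "growth_time l (norm (g x)) (norm (g (x + h) - g x) / norm (g x)) \<le> norm h / norm (g x)"
proof (rule field_le_epsilon)
  fix e :: real assume e: "e > 0"
  define m where "m = norm (g x)"
  have m: "m > 0" using m by (simp add: m_def)
  \<comment> \<open>This choice makes the growth time of \<open>\<delta>\<close>, where the smoothed norm starts, at most \<open>e\<close>.\<close>
  define \<delta> where "\<delta> = e * m * l m"
  have lm: "l m > 0" using l_pos m by simp
  have \<delta>: "\<delta> > 0" using e m lm by (simp add: \<delta>_def)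
  define w where "w t = g (x + t *\<^sub>R h) - g x" for t
  define r where "r t = sqrt (w t \<bullet> w t + \<delta>\<^sup>2)" for t
  have rpos: "r t > 0" for t using \<delta> by (simp add: r_def add_nonneg_pos)
  have wr: "norm (w t) \<le> r t" for t
    by (auto simp: r_def norm_eq_sqrt_inner)
  have seg: "x + t *\<^sub>R h \<in> X" if "t \<in> {0..1}" for t
    using segment_in_X[OF x xh] that by auto
  define r' where "r' t = (w t \<bullet> D (x + t *\<^sub>R h) h) / r t" for t
  have dr: "(r has_derivative (\<lambda>s. s * r' t)) (at t within {0..1})" if t: "t \<in> {0..1}" for t
  proof -
    have X: "x + t *\<^sub>R h \<in> X" using seg t by blast
    have lin: "D (x + t *\<^sub>R h) (s *\<^sub>R h) = s *\<^sub>R D (x + t *\<^sub>R h) h" for s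
      using has_derivative_linear[OF hessian[OF X]] by (rule linear_scale)
    have dw: "(w has_derivative (\<lambda>s. s *\<^sub>R D (x + t *\<^sub>R h) h)) (at t within {0..1})"
      using has_derivative_diff[OF along_line[OF hessian[OF X] seg] has_derivative_const[of "g x"], of "{0..1}"]
      by (simp add: w_def[abs_def] lin)
    have d2: "((\<lambda>t. w t \<bullet> w t + \<delta>\<^sup>2) has_real_derivative 2 * (w t \<bullet> D (x + t *\<^sub>R h) h)) (at t within {0..1})"
      unfolding has_field_derivative_def
      by (auto intro!: derivative_eq_intros dw simp: inner_commute algebra_simps)
    have pos: "w t \<bullet> w t + \<delta>\<^sup>2 > 0" using \<delta> by (intro add_nonneg_pos) auto
    have "(r has_real_derivative inverse (sqrt (w t \<bullet> w t + \<delta>\<^sup>2)) / 2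
        * (2 * (w t \<bullet> D (x + t *\<^sub>R h) h))) (at t within {0..1})"
      unfolding r_def by (rule DERIV_chain2[OF DERIV_real_sqrt[OF pos] d2])
    moreover have "inverse (sqrt (w t \<bullet> w t + \<delta>\<^sup>2)) / 2 * (2 * (w t \<bullet> D (x + t *\<^sub>R h) h)) = r' t"
      unfolding r'_def r_def by (simp add: inverse_eq_divide)
    ultimately show ?thesis
      by (simp add: has_field_derivative_def mult_commute_abs)
  qed
  have r'_le: "r' t \<le> l (m + r t) * norm h" if t: "t \<in> {0..1}" for t
  proof -
    have X: "x + t *\<^sub>R h \<in> X" using seg t by blast
    have "norm (g (x + t *\<^sub>R h)) \<le> m + norm (w t)"
      unfolding m_def w_def using norm_triangle_ineq[of "g x" "g (x + t *\<^sub>R h) - g x"] by simp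
    then have "norm (g (x + t *\<^sub>R h)) \<le> m + r t" using wr[of t] by linarith
    then have ll: "l (norm (g (x + t *\<^sub>R h))) \<le> l (m + r t)" by (intro l_le) auto
    have "w t \<bullet> D (x + t *\<^sub>R h) h \<le> norm (w t) * norm (D (x + t *\<^sub>R h) h)"
      by (rule norm_cauchy_schwarz)
    also have "\<dots> \<le> r t * norm (D (x + t *\<^sub>R h) h)" by (intro mult_right_mono wr) auto
    finally have "r' t \<le> norm (D (x + t *\<^sub>R h) h)"
      using rpos[of t] by (simp add: r'_def divide_le_eq mult.commute)
    also have "\<dots> \<le> l (norm (g (x + t *\<^sub>R h))) * norm h" by (rule hessian_bound[OF X h])
    also have "\<dots> \<le> l (m + r t) * norm h" by (intro mult_right_mono ll) auto
    finally show ?thesis .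
  qed
  define q where "q t = growth_time l m (r t / m)" for t
  have dq: "(q has_derivative (\<lambda>s. s * (r' t / m / l (m + r t)))) (at t within {0..1})"
    if t: "0 \<le> t" "t \<le> 1" for t
  proof -
    have "at (r t / m) within {0..r t / m + 1} = at (r t / m)"
      using rpos[of t] m by (intro at_within_interior) (simp add: interior_atLeastAtMost_real)
    then have "(growth_time l m has_real_derivative 1 / l (m + m * (r t / m))) (at (r t / m))"
      using growth_time_has_derivative[of m "r t / m" "r t / m + 1"] m rpos[of t]
      by (simp add: less_imp_le)
    moreover have "((\<lambda>t. r t / m) has_real_derivative r' t / m) (at t within {0..1})"
      using dr[of t] t m by (auto simp: has_field_derivative_def mult_commute_abs intro!: derivative_eq_intros)
    ultimately have "(q has_real_derivative 1 / l (m + m * (r t / m)) * (r' t / m)) (at t within {0..1})"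
      unfolding q_def by (rule DERIV_chain2)
    moreover have "1 / l (m + m * (r t / m)) * (r' t / m) = r' t / m / l (m + r t)"
      using m by simp
    ultimately show ?thesis by (simp only: has_field_derivative_def mult_commute_abs)
  qed
  obtain t where t: "t \<in> {0..1}" "q 1 - q 0 = (1 - 0) * (r' t / m / l (m + r t))"
    using mvt_very_simple[of 0 1 q, OF _ dq] by auto
  have "l (m + r t) > 0" using l_pos m rpos[of t] by simp
  then have "r' t / m / l (m + r t) \<le> norm h / m"
    using r'_le[OF t(1)] m by (simp add: field_simps)
  then have q1: "q 1 \<le> q 0 + norm h / m" using t(2) by simp
  have "r 0 = \<delta>" using \<delta> by (simp add: r_def w_def)
  then have "q 0 = growth_time l m (\<delta> / m)" by (simp add: q_def)
  also have "\<dots> \<le> e"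
  proof -
    obtain v where v: "0 \<le> v" "growth_time l m (\<delta> / m) = (\<delta> / m) / l (m + m * v)"
      using growth_time_mean_value[of m 0 "\<delta> / m"] m \<delta> by auto
    have "l m \<le> l (m + m * v)" using v m by (intro l_le) auto
    then have "(\<delta> / m) / l (m + m * v) \<le> (\<delta> / m) / l m"
      using lm \<delta> m by (intro divide_left_mono) auto
    also have "\<dots> = e" using lm m by (simp add: \<delta>_def)
    finally show ?thesis using v by simp
  qed
  finally have "q 1 \<le> norm h / m + e" using q1 by simp
  moreover have "growth_time l m (norm (w 1) / m) \<le> q 1"
  proof (cases "norm (w 1) = r 1")
    case False
    then have "norm (w 1) / m < r 1 / m"
      using wr[of 1] m by (intro divide_strict_right_mono) auto
    then show ?thesis using growth_time_strict_mono[of m "norm (w 1) / m" "r 1 / m"] m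
      by (simp add: q_def)
  qed (simp add: q_def)
  ultimately show "growth_time l (norm (g x)) (norm (g (x + h) - g x) / norm (g x)) \<le> norm h / norm (g x) + e"
    by (simp add: m_def w_def)
qed

text \<open>
  On a segment of length at most \<open>\<gamma> * m\<close> the elapsed time does not suffice for the gradient to change
  by more than \<open>m\<close>, and below this value the growth time lies above its chord.
\<close>

lemma gradient_lipschitz_at:
  assumes x: "x \<in> X" and h: "h \<in> S" and xh: "x + h \<in> X"
    and m: "norm (g x) > 0" and step: "norm h \<le> step_size l (norm (g x)) * norm (g x)"
  shows "norm (g (x + h) - g x) \<le> norm h / step_size l (norm (g x))"
proof -
  define m where "m = norm (g x)"
  define \<gamma> where "\<gamma> = step_size l m"
  define s where "s = norm (g (x + h) - g x) / m"
  have mp: "m > 0" using m by (simp add: m_def)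
  have \<gamma>: "\<gamma> > 0" unfolding \<gamma>_def using mp by (intro step_size_ge) simp
  have le: "growth_time l m s \<le> norm h / m"
    using growth_time_gradient_change[OF x h xh m] by (simp add: m_def s_def)
  also have "\<dots> \<le> \<gamma>"
    using step mp by (simp add: m_def[symmetric] \<gamma>_def[symmetric] divide_le_eq)
  finally have "growth_time l m s \<le> growth_time l m 1"
    by (simp add: \<gamma>_def step_size_eq_growth_time)
  then have s1: "s \<le> 1"
    using growth_time_strict_mono[of m 1 s] mp by (meson less_imp_le not_less zero_le_one)
  have "s * \<gamma> \<le> growth_time l m s"
    using growth_time_above_chord[of m s] s1 mp
    by (simp add: \<gamma>_def step_size_eq_growth_time s_def)
  then have "s * \<gamma> \<le> norm h / m" using le by simp
  then show ?thesis
    using mp \<gamma> by (simp add: s_def m_def[symmetric] \<gamma>_def[symmetric] field_simps)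
qed

text \<open>
  The end point is required to lie in \<open>X\<close> because this bound is what shows, below, that every
  sufficiently short segment stays in \<open>X\<close>.
\<close>

lemma quadratic_upper_bound_within:
  assumes x: "x \<in> X" and h: "h \<in> S" and xh: "x + h \<in> X"
    and m: "norm (g x) > 0" and step: "norm h \<le> step_size l (norm (g x)) * norm (g x)"
  shows "F (x + h) \<le> F x + g x \<bullet> h + (norm h)\<^sup>2 / (2 * step_size l (norm (g x)))"
proof -
  define \<gamma> where "\<gamma> = step_size l (norm (g x))"
  have \<gamma>: "\<gamma> > 0" unfolding \<gamma>_def by (intro step_size_ge) simp
  define q where "q t = F (x + t *\<^sub>R h) - t * (g x \<bullet> h) - t\<^sup>2 * ((norm h)\<^sup>2 / (2 * \<gamma>))" for t
  have seg: "x + t *\<^sub>R h \<in> X" if "0 \<le> t" "t \<le> 1" for t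
    using segment_in_X[OF x xh] that by auto
  have dq: "(q has_derivative (\<lambda>s. s * ((g (x + t *\<^sub>R h) - g x) \<bullet> h - t * ((norm h)\<^sup>2 / \<gamma>)))) (at t within {0..1})"
    if t: "0 \<le> t" "t \<le> 1" for t
  proof -
    have "((\<lambda>t. F (x + t *\<^sub>R h)) has_real_derivative g (x + t *\<^sub>R h) \<bullet> h) (at t within {0..1})"
      using along_line[OF gradient[OF seg[OF t]], of "{0..1}"] seg
      by (simp add: has_field_derivative_def mult_commute_abs)
    then have "(q has_real_derivative ((g (x + t *\<^sub>R h) - g x) \<bullet> h - t * ((norm h)\<^sup>2 / \<gamma>))) (at t within {0..1})"
      unfolding q_def using \<gamma>
      by (auto intro!: derivative_eq_intros simp: inner_diff_left field_simps)
    then show ?thesis by (simp add: has_field_derivative_def mult_commute_abs)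
  qed
  obtain t where t: "t \<in> {0..1}"
    and eq: "q 1 - q 0 = (1 - 0) * ((g (x + t *\<^sub>R h) - g x) \<bullet> h - t * ((norm h)\<^sup>2 / \<gamma>))"
    using mvt_very_simple[of 0 1 q, OF _ dq] by auto
  have "norm (t *\<^sub>R h) \<le> step_size l (norm (g x)) * norm (g x)"
    using t step mult_left_le_one_le[of "norm h" t] by auto
  then have "norm (g (x + t *\<^sub>R h) - g x) \<le> norm (t *\<^sub>R h) / \<gamma>"
    unfolding \<gamma>_def using t h subspace_S m
    by (intro gradient_lipschitz_at x seg) (auto simp: subspace_scale)
  then have "(g (x + t *\<^sub>R h) - g x) \<bullet> h \<le> norm (t *\<^sub>R h) / \<gamma> * norm h"
    using norm_cauchy_schwarz[of "g (x + t *\<^sub>R h) - g x" h] mult_right_mono[of _ _ "norm h"]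
    by (meson norm_ge_zero order_trans)
  also have "\<dots> = t * ((norm h)\<^sup>2 / \<gamma>)" using t by (simp add: power2_eq_square)
  finally have "q 1 - q 0 \<le> 0" unfolding eq by simp
  then show ?thesis by (simp add: q_def \<gamma>_def)
qed

text \<open>
  Moving along the segment from \<open>x\<close>, one cannot leave \<open>X\<close>: the quadratic bound confines the part of
  the segment in \<open>X\<close> to a fixed sublevel set, which makes that part closed as well as open.
\<close>

lemma ball_in_domain:
  assumes x: "x \<in> X" and h: "h \<in> S"
    and m: "norm (g x) > 0" and step: "norm h \<le> step_size l (norm (g x)) * norm (g x)"
  shows "x + h \<in> X"
proof -
  define \<gamma> where "\<gamma> = step_size l (norm (g x))"
  have \<gamma>: "\<gamma> > 0" unfolding \<gamma>_def by (intro step_size_ge) simp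
  define c where "c = F x + norm (g x) * norm h + (norm h)\<^sup>2 / (2 * \<gamma>)"
  define k where "k t = x + t *\<^sub>R h" for t :: real
  define B where "B = {t \<in> {0..1}. k t \<in> X}"
  have kc: "continuous_on A k" for A unfolding k_def by (intro continuous_intros)
  have kS: "k t \<in> S" for t
    using x X_subset_S h subspace_S by (auto simp: k_def subspace_add subspace_scale)
  have bd: "F (k t) \<le> c" if "t \<in> B" for t
  proof -
    have t: "0 \<le> t" "t \<le> 1" "x + t *\<^sub>R h \<in> X" using that by (auto simp: B_def k_def)
    have n: "norm (t *\<^sub>R h) \<le> norm h" using t mult_left_le_one_le[of "norm h" t] by auto
    have "F (k t) \<le> F x + g x \<bullet> (t *\<^sub>R h) + (norm (t *\<^sub>R h))\<^sup>2 / (2 * \<gamma>)"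
      unfolding k_def \<gamma>_def using n step m t h subspace_S
      by (intro quadratic_upper_bound_within x) (auto simp: subspace_scale)
    also have "\<dots> \<le> c"
      unfolding c_def
    proof (intro add_mono order_refl divide_right_mono power_mono n)
      show "g x \<bullet> (t *\<^sub>R h) \<le> norm (g x) * norm h"
        using norm_cauchy_schwarz[of "g x" "t *\<^sub>R h"] n mult_left_mono[OF n, of "norm (g x)"]
        by simp
    qed (use \<gamma> in auto)
    finally show ?thesis .
  qed
  have "B = {0..1} \<inter> k -` X" by (auto simp: B_def)
  then have "openin (top_of_set {0..1}) B"
    using continuous_openin_preimage[OF kc _ open_X, of "{0..1}"] kS by auto
  moreover have "B = {0..1} \<inter> k -` {y \<in> X. F y \<le> c}" using bd by (auto simp: B_def)
  then have "closedin (top_of_set {0..1}) B"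
    using continuous_closedin_preimage[OF kc closed_sublevel] by auto
  moreover have "0 \<in> B" using x by (simp add: B_def k_def)
  moreover have "connected {0..1::real}" by simp
  ultimately have "B = {0..1}" unfolding connected_clopen by blast
  then have "1 \<in> B" by simp
  then show ?thesis by (simp add: B_def k_def)
qed

lemma quadratic_upper_bound:
  assumes x: "x \<in> X" and h: "h \<in> S"
    and m: "norm (g x) > 0" and step: "norm h \<le> step_size l (norm (g x)) * norm (g x)"
  shows "F (x + h) \<le> F x + g x \<bullet> h + (norm h)\<^sup>2 / (2 * step_size l (norm (g x)))"
  by (rule quadratic_upper_bound_within[OF x h ball_in_domain[OF assms] m step])

definition gd_step :: "'a \<Rightarrow> 'a"
  where "gd_step x = x - step_size l (norm (g x)) *\<^sub>R g x"

lemma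
  assumes x: "x \<in> X"
  shows gd_step_in_domain: "gd_step x \<in> X"
    and gd_step_descent: "F (gd_step x) \<le> F x - step_size l (norm (g x)) / 2 * (norm (g x))\<^sup>2"
proof -
  define \<gamma> where "\<gamma> = step_size l (norm (g x))"
  have \<gamma>: "\<gamma> > 0" unfolding \<gamma>_def by (intro step_size_ge) simp
  define h where "h = - \<gamma> *\<^sub>R g x"
  have h: "h \<in> S" unfolding h_def by (intro subspace_scale subspace_S gradient_in_S x)
  have nh: "norm h = \<gamma> * norm (g x)" using \<gamma> by (simp add: h_def)
  have st: "gd_step x = x + h" by (simp add: gd_step_def h_def \<gamma>_def)
  have "gd_step x \<in> X \<and> F (gd_step x) \<le> F x - \<gamma> / 2 * (norm (g x))\<^sup>2"
  proof (cases "g x = 0")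
    case True
    then show ?thesis using x by (simp add: gd_step_def)
  next
    case False
    then have m: "norm (g x) > 0" by simp
    have "F (x + h) \<le> F x + g x \<bullet> h + (norm h)\<^sup>2 / (2 * \<gamma>)"
      unfolding \<gamma>_def using nh by (intro quadratic_upper_bound x h m) (simp add: \<gamma>_def)
    moreover have "g x \<bullet> h + (norm h)\<^sup>2 / (2 * \<gamma>) = - (\<gamma> / 2 * (norm (g x))\<^sup>2)"
      unfolding nh using \<gamma>
      by (simp add: h_def power2_norm_eq_inner[symmetric] field_simps power2_eq_square)
    moreover have "x + h \<in> X" using ball_in_domain[OF x h m] nh by (simp add: \<gamma>_def)
    ultimately show ?thesis unfolding st by linarith
  qed
  then show "gd_step x \<in> X" "F (gd_step x) \<le> F x - step_size l (norm (g x)) / 2 * (norm (g x))\<^sup>2"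
    by (auto simp: \<gamma>_def)
qed

end

section \<open>Gradient descent on a convex function\<close>

locale convex_generalized_smooth = generalized_smooth +
  assumes convex_F: "convex_on X F"
begin

text \<open>The one-dimensional statement, applied to the restriction of \<open>F\<close> to the line through both points.\<close>

lemma above_tangent:
  assumes y: "y \<in> X" and z: "z \<in> X"
  shows "F y + g y \<bullet> (z - y) \<le> F z"
proof -
  define k where "k t = y + t *\<^sub>R (z - y)" for t :: real
  define A where "A = k -` X"
  have kS: "k t \<in> S" for t
    unfolding k_def using y z X_subset_S subspace_S
    by (intro subspace_add subspace_scale subspace_diff) auto
  obtain U where U: "open U" "X = S \<inter> U" using open_X by (auto simp: openin_open)
  have "A = k -` U" using kS U by (auto simp: A_def)
  moreover have "continuous_on UNIV k" unfolding k_def by (intro continuous_intros)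
  ultimately have "open A" using U(1) by (simp add: open_vimage)
  have aff: "k ((1 - u) * s + u * t) = (1 - u) *\<^sub>R k s + u *\<^sub>R k t" for s t u
    by (simp add: k_def algebra_simps)
  have "convex A"
    unfolding convex_alt A_def using convex_X by (auto simp: aff convex_alt)
  have conv: "convex_on A (F \<circ> k)"
  proof (rule convex_onI)
    fix t a b :: real assume "0 < t" "t < 1" "a \<in> A" "b \<in> A"
    then show "(F \<circ> k) ((1 - t) *\<^sub>R a + t *\<^sub>R b) \<le> (1 - t) * (F \<circ> k) a + t * (F \<circ> k) b"
      using convex_onD[OF convex_F, of t "k a" "k b"] by (simp add: aff A_def)
  qed fact
  have "((\<lambda>t. F (y + t *\<^sub>R (z - y))) has_real_derivative g y \<bullet> (z - y)) (at 0 within A)"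
    using along_line[of F "\<lambda>h. g y \<bullet> h" y 0 "z - y" A] gradient[OF y]
    by (auto simp: has_field_derivative_def mult_commute_abs A_def k_def)
  then have d: "((F \<circ> k) has_real_derivative g y \<bullet> (z - y)) (at 0 within A)"
    by (simp add: comp_def k_def)
  have "0 \<in> A" "1 \<in> A" using y z by (auto simp: A_def k_def)
  then have "(F \<circ> k) 1 - (F \<circ> k) 0 \<ge> (g y \<bullet> (z - y)) * (1 - 0)"
    using \<open>open A\<close> \<open>convex A\<close>
    by (intro convex_on_imp_above_tangent[OF conv _ _ _ d] convex_connected) (auto simp: interior_open)
  then show ?thesis by (simp add: k_def)
qed

text \<open>
  Let \<open>y = x - \<gamma> *\<^sub>R g x\<close> be the next point. As for co-coercivity,
  the quadratic upper bound around \<open>x\<close> and the tangent at \<open>y\<close> are compared at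
  \<open>x + \<gamma> *\<^sub>R (g y - g x)\<close>, the minimiser of their difference, which lies in the admissible ball
  because \<open>norm (g y - g x) \<le> norm (g x)\<close>. This gives
  \<open>\<gamma> / 2 * (norm (g x))\<^sup>2 + \<gamma> / 2 * (norm (g y))\<^sup>2 \<le> F x - F y\<close>, while the tangent at \<open>x\<close> gives
  \<open>F x - F y \<le> \<gamma> * (norm (g x))\<^sup>2\<close>.
\<close>

lemma gd_step_gradient_le:
  assumes x: "x \<in> X"
  shows "norm (g (gd_step x)) \<le> norm (g x)"
proof (cases "g x = 0")
  case True
  then show ?thesis by (simp add: gd_step_def)
next
  case False
  then have m: "norm (g x) > 0" by simp
  define \<gamma> where "\<gamma> = step_size l (norm (g x))"
  have \<gamma>: "\<gamma> > 0" unfolding \<gamma>_def by (intro step_size_ge) simp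
  define y where "y = gd_step x"
  define h where "h = \<gamma> *\<^sub>R (g y - g x)"
  have y: "y \<in> X" unfolding y_def by (rule gd_step_in_domain[OF x])
  have yx: "y = x + (- \<gamma> *\<^sub>R g x)" by (simp add: y_def gd_step_def \<gamma>_def)
  have h: "h \<in> S"
    unfolding h_def by (intro subspace_scale subspace_diff subspace_S gradient_in_S x y)
  have "norm (g y - g x) \<le> norm (- \<gamma> *\<^sub>R g x) / \<gamma>"
    unfolding yx \<gamma>_def
    by (rule gradient_lipschitz_at)
      (use x y m \<gamma> subspace_S gradient_in_S in \<open>auto simp: subspace_scale subspace_neg yx \<gamma>_def\<close>)
  then have "norm (g y - g x) \<le> norm (g x)" using \<gamma> by simp
  then have step: "norm h \<le> \<gamma> * norm (g x)" using \<gamma> by (simp add: h_def)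
  then have z: "x + h \<in> X" unfolding \<gamma>_def by (intro ball_in_domain x h m)
  have "F y + g y \<bullet> (x + h - y) \<le> F (x + h)" by (rule above_tangent[OF y z])
  also have "\<dots> \<le> F x + g x \<bullet> h + (norm h)\<^sup>2 / (2 * \<gamma>)"
    using step unfolding \<gamma>_def by (intro quadratic_upper_bound x h m)
  also have "F x \<le> F y + g x \<bullet> (x - y)"
    using above_tangent[OF x y] by (simp add: inner_diff_right)
  finally have "g y \<bullet> (x + h - y) \<le> g x \<bullet> (x - y) + g x \<bullet> h + (norm h)\<^sup>2 / (2 * \<gamma>)" by simp
  moreover have "g y \<bullet> (x + h - y) = \<gamma> * (g y \<bullet> g y)"
    unfolding h_def by (subst (2) yx) (simp add: algebra_simps)
  moreover have "g x \<bullet> (x - y) = \<gamma> * (g x \<bullet> g x)"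
    by (subst yx) simp
  moreover have "g x \<bullet> h = \<gamma> * (g x \<bullet> g y - g x \<bullet> g x)"
    by (simp add: h_def inner_diff_right)
  moreover have "(norm h)\<^sup>2 = \<gamma> * \<gamma> * (g y \<bullet> g y - 2 * (g x \<bullet> g y) + g x \<bullet> g x)"
    unfolding power2_norm_eq_inner h_def
    by (simp add: inner_diff_left inner_diff_right inner_commute[of "g y" "g x"] algebra_simps)
  then have "(norm h)\<^sup>2 / (2 * \<gamma>) = \<gamma> / 2 * (g y \<bullet> g y - 2 * (g x \<bullet> g y) + g x \<bullet> g x)"
    using \<gamma> by simp
  ultimately have "\<gamma> * (g y \<bullet> g y) \<le> \<gamma> * (g x \<bullet> g x)"
    by (simp add: algebra_simps)
  then have "g y \<bullet> g y \<le> g x \<bullet> g x" using \<gamma> by simp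
  then show ?thesis by (simp add: y_def norm_le)
qed

text \<open>
  Expanding the square leaves the term \<open>\<gamma>\<^sup>2 * (norm (g x))\<^sup>2\<close>, which the decrease of \<open>F\<close> in the step
  pays for. This is why the gap on the right is that of the new point.
\<close>

lemma gd_step_dist:
  assumes x: "x \<in> X" and z: "z \<in> X"
  shows "(norm (gd_step x - z))\<^sup>2 \<le> (norm (x - z))\<^sup>2 - 2 * step_size l (norm (g x)) * (F (gd_step x) - F z)"
proof -
  define \<gamma> where "\<gamma> = step_size l (norm (g x))"
  have \<gamma>: "\<gamma> > 0" unfolding \<gamma>_def by (intro step_size_ge) simp
  have "F x - F z \<le> g x \<bullet> (x - z)" using above_tangent[OF x z] by (simp add: inner_diff_right)
  then have "F (gd_step x) - F z \<le> g x \<bullet> (x - z) - \<gamma> / 2 * (norm (g x))\<^sup>2"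
    using gd_step_descent[OF x] by (simp add: \<gamma>_def)
  then have "2 * \<gamma> * (F (gd_step x) - F z) \<le> 2 * \<gamma> * (g x \<bullet> (x - z) - \<gamma> / 2 * (norm (g x))\<^sup>2)"
    using \<gamma> by simp
  also have "\<dots> = (norm (x - z))\<^sup>2 - (norm (gd_step x - z))\<^sup>2"
    unfolding gd_step_def \<gamma>_def[symmetric] power2_norm_eq_inner
    by (simp add: inner_diff_left inner_diff_right inner_commute algebra_simps)
  finally show ?thesis by (simp add: \<gamma>_def)
qed

context
  fixes x :: "nat \<Rightarrow> 'a"
  assumes x0: "x 0 \<in> X" and iter: "\<And>k. x (Suc k) = gd_step (x k)"
begin

lemma iterates_in_domain: "x k \<in> X"
  by (induction k) (simp_all add: x0 iter gd_step_in_domain)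

lemma iterates_descent: "F (x (Suc k)) \<le> F (x k)"
proof -
  have "0 \<le> step_size l (norm (g (x k))) / 2 * (norm (g (x k)))\<^sup>2"
    using step_size_ge(2)[of "norm (g (x k))"] by simp
  then show ?thesis
    using gd_step_descent[OF iterates_in_domain, of k] by (simp add: iter)
qed

lemma iterates_gradient_le: "norm (g (x k)) \<le> norm (g (x 0))"
proof (induction k)
  case (Suc k)
  have "norm (g (x (Suc k))) \<le> norm (g (x k))"
    unfolding iter by (rule gd_step_gradient_le[OF iterates_in_domain])
  then show ?case using Suc by linarith
qed simp

lemma total_step_bound:
  assumes z: "z \<in> X"
  shows "2 * (\<Sum>k<T. step_size l (norm (g (x k)))) * (F (x T) - F z) \<le> (norm (x 0 - z))\<^sup>2"
proof -
  have "(norm (x T - z))\<^sup>2 + 2 * (\<Sum>k<T. step_size l (norm (g (x k)))) * (F (x T) - F z) \<le> (norm (x 0 - z))\<^sup>2"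
  proof (induction T)
    case (Suc T)
    let ?\<gamma> = "step_size l (norm (g (x T)))" and ?s = "\<Sum>k<T. step_size l (norm (g (x k)))"
    have "?s \<ge> 0" by (intro sum_nonneg step_size_ge(2)[THEN less_imp_le]) simp
    then have "2 * ?s * (F (x (Suc T)) - F z) \<le> 2 * ?s * (F (x T) - F z)"
      using iterates_descent[of T] by (intro mult_left_mono) auto
    moreover have "(norm (x (Suc T) - z))\<^sup>2 \<le> (norm (x T - z))\<^sup>2 - 2 * ?\<gamma> * (F (x (Suc T)) - F z)"
      using gd_step_dist[OF iterates_in_domain z, of T] by (simp add: iter)
    ultimately show ?case using Suc by (simp add: algebra_simps)
  qed simp
  then show ?thesis by (smt (verit) zero_le_power2)
qed

lemma accuracy_if_total_step_large:
  assumes z: "z \<in> X" and \<epsilon>: "\<epsilon> > 0" and large: "(norm (x 0 - z))\<^sup>2 \<le> 2 * \<epsilon> * (\<Sum>k<T. step_size l (norm (g (x k))))"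
  shows "F (x T) - F z \<le> \<epsilon>"
proof (cases "T = 0")
  case True
  then show ?thesis using assms by simp
next
  case False
  then have "0 < (\<Sum>k<T. step_size l (norm (g (x k))))"
    by (intro sum_pos step_size_ge) auto
  then have s: "0 < 2 * (\<Sum>k<T. step_size l (norm (g (x k))))" (is "0 < ?s") by simp
  have "?s * (F (x T) - F z) \<le> ?s * \<epsilon>"
    using total_step_bound[OF z, of T] large by (simp add: mult.commute mult.left_commute)
  then show ?thesis using s mult_le_cancel_left_pos by blast
qed

lemma accuracy_from_initial_gradient:
  assumes z: "z \<in> X" and \<epsilon>: "\<epsilon> > 0" and T: "l (2 * norm (g (x 0))) * (norm (x 0 - z))\<^sup>2 / (2 * \<epsilon>) \<le> real T"
  shows "F (x T) - F z \<le> \<epsilon>"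
proof (rule accuracy_if_total_step_large[OF z \<epsilon>])
  let ?L = "l (2 * norm (g (x 0)))"
  have L: "?L > 0" by (intro l_pos) simp
  have "1 / ?L \<le> step_size l (norm (g (x k)))" for k
  proof -
    have "l (2 * norm (g (x k))) \<le> ?L" by (intro l_le) (auto intro: iterates_gradient_le)
    then have "1 / ?L \<le> 1 / l (2 * norm (g (x k)))" by (intro frac_le) (auto intro!: l_pos)
    also have "\<dots> \<le> step_size l (norm (g (x k)))" by (intro step_size_ge) simp
    finally show ?thesis .
  qed
  then have "(\<Sum>k<T. 1 / ?L) \<le> (\<Sum>k<T. step_size l (norm (g (x k))))" by (intro sum_mono)
  then have "2 * \<epsilon> * (real T / ?L) \<le> 2 * \<epsilon> * (\<Sum>k<T. step_size l (norm (g (x k))))"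
    using \<epsilon> by (intro mult_left_mono) auto
  moreover have "(norm (x 0 - z))\<^sup>2 \<le> 2 * \<epsilon> * (real T / ?L)"
    using T L \<epsilon> by (simp add: field_simps)
  ultimately show "(norm (x 0 - z))\<^sup>2 \<le> 2 * \<epsilon> * (\<Sum>k<T. step_size l (norm (g (x k))))" by linarith
qed

text \<open>
  Each step contributes at least \<open>1\<close> to a sum of two budgets: the step size times \<open>2 * l 0\<close>, which a
  step at gradient norm at most \<open>M\<close> fills, and the decrease of \<open>F\<close> divided by half of
  \<open>M\<^sup>2 / l (2 * M)\<close>, which any other step fills. The second budget telescopes and is bounded
  independently of \<open>T\<close>, so the sum of the step sizes grows linearly with the remaining steps.
\<close>

lemma accuracy_from_threshold:
  assumes z: "z \<in> X" and \<epsilon>: "\<epsilon> > 0" and M: "M > 0" "l (2 * M) \<le> 2 * l 0"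
    and psi: "strict_mono_on {0..} (\<lambda>s. s\<^sup>2 / l (2 * s))"
    and min: "F z \<le> F (x T)"
    and T: "l 0 * (norm (x 0 - z))\<^sup>2 / \<epsilon> + 2 * (F (x 0) - F z) / (M\<^sup>2 / l (2 * M)) \<le> real T"
  shows "F (x T) - F z \<le> \<epsilon>"
proof (rule accuracy_if_total_step_large[OF z \<epsilon>])
  define p where "p = M\<^sup>2 / l (2 * M)"
  have p: "p > 0" unfolding p_def using M by (intro divide_pos_pos l_pos) auto
  have l0: "l 0 > 0" by (simp add: l_pos)
  have each: "1 \<le> 2 * l 0 * step_size l (norm (g (x k))) + 2 / p * (F (x k) - F (x (Suc k)))" for k
  proof -
    define m where "m = norm (g (x k))"
    have m: "m \<ge> 0" by (simp add: m_def)
    have \<gamma>: "1 / l (2 * m) \<le> step_size l m" "0 < step_size l m" using step_size_ge m by auto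
    show ?thesis
    proof (cases "m \<le> M")
      case True
      have "l (2 * m) \<le> l (2 * M)" using True m by (intro l_le) auto
      then have "l (2 * m) \<le> 2 * l 0" using M by linarith
      then have "1 / (2 * l 0) \<le> 1 / l (2 * m)" using m by (intro frac_le l_pos) auto
      then have "1 / (2 * l 0) \<le> step_size l m" using \<gamma> by linarith
      then have "1 \<le> 2 * l 0 * step_size l m" using l0 by (simp add: field_simps)
      moreover have "0 \<le> 2 / p * (F (x k) - F (x (Suc k)))"
        using iterates_descent[of k] p by simp
      ultimately show ?thesis by (simp add: m_def)
    next
      case False
      then have "p < m\<^sup>2 / l (2 * m)"
        using strict_mono_onD[OF psi, of M m] M by (simp add: p_def)
      also have "\<dots> = m\<^sup>2 * (1 / l (2 * m))" by simp
      also have "\<dots> \<le> m\<^sup>2 * step_size l m" using \<gamma> by (intro mult_left_mono) auto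
      also have "\<dots> \<le> 2 * (F (x k) - F (x (Suc k)))"
        using gd_step_descent[OF iterates_in_domain, of k] by (simp add: iter m_def mult.commute)
      finally have "1 \<le> 2 / p * (F (x k) - F (x (Suc k)))" using p by (simp add: field_simps)
      moreover have "0 \<le> 2 * l 0 * step_size l m" using l0 \<gamma> by simp
      ultimately show ?thesis by (simp add: m_def)
    qed
  qed
  have "real T \<le> (\<Sum>k<T. 2 * l 0 * step_size l (norm (g (x k))) + 2 / p * (F (x k) - F (x (Suc k))))"
    using sum_mono[of "{..<T}" "\<lambda>_. 1", OF each] by simp
  also have "\<dots> = 2 * l 0 * (\<Sum>k<T. step_size l (norm (g (x k)))) + 2 / p * (F (x 0) - F (x T))"
    by (simp only: sum.distrib sum_distrib_left[symmetric] sum_lessThan_telescope'[of "\<lambda>k. F (x k)"])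
  also have "\<dots> \<le> 2 * l 0 * (\<Sum>k<T. step_size l (norm (g (x k)))) + 2 / p * (F (x 0) - F z)"
    using min p by (intro add_left_mono mult_left_mono) auto
  finally have "l 0 * (norm (x 0 - z))\<^sup>2 / \<epsilon> \<le> 2 * l 0 * (\<Sum>k<T. step_size l (norm (g (x k))))"
    using T unfolding p_def[symmetric] by (simp only: times_divide_eq_left)
  then have "l 0 * (norm (x 0 - z))\<^sup>2 \<le> l 0 * (2 * \<epsilon> * (\<Sum>k<T. step_size l (norm (g (x k)))))"
    using \<epsilon> by (simp add: field_simps)
  then show "(norm (x 0 - z))\<^sup>2 \<le> 2 * \<epsilon> * (\<Sum>k<T. step_size l (norm (g (x k))))"
    using l0 by simp
qed

end

end

section \<open>Extended-valued functions\<close>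

lemma bounded_linear_proj_Rn: "bounded_linear (proj_Rn d)"
  unfolding proj_Rn_def unit_inner[symmetric]
  by (rule bounded_linear_sum,
      rule bounded_linear_compose[OF bounded_linear_scaleR_left bounded_linear_inner_right])

text \<open>
  Continuity of \<open>f\<close> as an extended-valued function on the closure of its domain is what makes the
  sublevel sets closed: such a set is the preimage of a closed ray, and a point of it has a finite value
  and so belongs to the domain.
\<close>

lemma (in growth_bound) convex_generalized_smooth_if_l_smooth:
  assumes "\<forall>y\<in>Rn d. f y \<noteq> -\<infinity>"
    and op: "openin (top_of_set (Rn d)) (fin_dom d f)" and "convex (fin_dom d f)"
    and sm: "l_smooth d l f"
    and "convex_on (fin_dom d f) (\<lambda>y. real_of_ereal (f y))"
  shows "convex_generalized_smooth l (Rn d) (fin_dom d f) (\<lambda>y. real_of_ereal (f y)) (grad d f)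
    (\<lambda>y. frechet_derivative (grad d f) (at y within fin_dom d f))"
proof
  let ?X = "fin_dom d f"
  show "closed {y \<in> ?X. real_of_ereal (f y) \<le> c}" for c
  proof -
    have sub: "closure ?X \<subseteq> Rn d"
      using op closed_Rn by (intro closure_minimal openin_imp_subset)
    have real_le: "real_of_ereal (f y) \<le> c \<longleftrightarrow> f y \<le> ereal c" if "y \<in> ?X" for y
      using that assms(1) by (cases "f y") (auto simp: fin_dom_def)
    have fin: "f y \<noteq> \<infinity>" if "f y \<le> ereal c" for y
      using that by auto
    have "{y \<in> ?X. real_of_ereal (f y) \<le> c} = closure ?X \<inter> f -` {..ereal c}"
      using closure_subset[of ?X] real_le sub fin by (auto simp: fin_dom_def)
    then show ?thesis
      using sm by (auto simp: l_smooth_def intro: continuous_closed_preimage)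
  qed
  fix y assume y: "y \<in> ?X"
  have "(\<lambda>y. real_of_ereal (f y)) differentiable (at y within ?X)"
    using sm y by (auto simp: l_smooth_def differentiable_on_def)
  then show "grad d f y \<in> Rn d"
    "((\<lambda>y. real_of_ereal (f y)) has_derivative (\<lambda>h. grad d f y \<bullet> h)) (at y within ?X)"
    using grad_has_derivative[OF op y] by auto
  show D: "(grad d f has_derivative frechet_derivative (grad d f) (at y within ?X)) (at y within ?X)"
    using sm y by (auto simp: l_smooth_def differentiable_on_def frechet_derivative_works)
  fix h assume h: "h \<in> Rn d"
  have "bounded_linear (hess d f y)"
    unfolding hess_def
    by (rule bounded_linear_compose[OF has_derivative_bounded_linear[OF D] bounded_linear_proj_Rn])
  then have "norm (hess d f y h) \<le> onorm (hess d f y) * norm h" by (rule onorm)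
  also have "\<dots> \<le> l (norm (grad d f y)) * norm h"
    using sm y by (auto simp: l_smooth_def intro: mult_right_mono)
  finally show "norm (frechet_derivative (grad d f) (at y within ?X) h) \<le> l (norm (grad d f y)) * norm h"
    using h by (simp add: hess_def proj_Rn_eq)
qed (use assms subspace_Rn in auto)

theorem corollary8p4:
  fixes l :: "real \<Rightarrow> real"
  assumes l_mono: "mono_on {0..} l"
    and l_pos: "\<forall>s\<ge>0. l s > 0"
    and l_lipschitz: "\<forall>s\<ge>0. \<exists>u>0. \<exists>L. L-lipschitz_on (cball s u \<inter> {0..}) l"
    and psi2: "strict_mono_on {0..} (\<lambda>s. s\<^sup>2 / l (2 * s))"
  shows "\<forall>\<Delta>\<ge>0::real. \<exists>Tbar\<ge>0::real.
    \<forall>(d::nat) (f :: fin_seq \<Rightarrow> ereal) (xs :: fin_seq) (x :: nat \<Rightarrow> fin_seq) (\<epsilon>::real) (T::nat).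
      (\<forall>y\<in>Rn d. f y \<noteq> -\<infinity>) \<and>
      openin (top_of_set (Rn d)) (fin_dom d f) \<and> convex (fin_dom d f) \<and>
      l_smooth d l f \<and>
      convex_on (fin_dom d f) (\<lambda>y. real_of_ereal (f y)) \<and>
      xs \<in> Rn d \<and> (\<forall>y\<in>Rn d. f xs \<le> f y) \<and>
      x 0 \<in> fin_dom d f \<and> f (x 0) - f xs = ereal \<Delta> \<and>
      (\<forall>k. x (Suc k) = x k - step_size l (norm (grad d f (x k))) *\<^sub>R grad d f (x k)) \<and>
      \<epsilon> > 0 \<and>
      real T \<ge> l 0 * (norm (x 0 - xs))\<^sup>2 / \<epsilon>
        + min Tbar (l (2 * norm (grad d f (x 0))) * (norm (x 0 - xs))\<^sup>2 / (2 * \<epsilon>))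
      \<longrightarrow> f (x T) - f xs \<le> ereal \<epsilon>"
proof (intro allI impI)
  fix \<Delta> :: real assume \<Delta>: "\<Delta> \<ge> 0"
  have cont: "continuous_on {0..} l" by (rule continuous_on_if_locally_lipschitz[OF l_lipschitz])
  interpret growth_bound l
    using l_mono l_pos cont by unfold_locales auto
  obtain e where e: "e > 0" "\<And>s. s \<ge> 0 \<Longrightarrow> dist s 0 < e \<Longrightarrow> dist (l s) (l 0) < l 0"
    using cont[unfolded continuous_on_iff, rule_format, of 0 "l 0"] l_pos by auto
  \<comment> \<open>Any \<open>M\<close> with \<open>0 < 2 * M < e\<close> would do.\<close>
  define M where "M = e / 4"
  have M: "M > 0" "l (2 * M) \<le> 2 * l 0"
    using e(1) e(2)[of "2 * M"] by (auto simp: M_def dist_real_def)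
  define Tbar where "Tbar = 2 * \<Delta> / (M\<^sup>2 / l (2 * M))"
  have "Tbar \<ge> 0" unfolding Tbar_def using \<Delta> M l_pos[rule_format, of "2 * M"] by simp
  moreover have "f (x T) - f xs \<le> ereal \<epsilon>"
    if H: "(\<forall>y\<in>Rn d. f y \<noteq> -\<infinity>) \<and>
      openin (top_of_set (Rn d)) (fin_dom d f) \<and> convex (fin_dom d f) \<and>
      l_smooth d l f \<and>
      convex_on (fin_dom d f) (\<lambda>y. real_of_ereal (f y)) \<and>
      xs \<in> Rn d \<and> (\<forall>y\<in>Rn d. f xs \<le> f y) \<and>
      x 0 \<in> fin_dom d f \<and> f (x 0) - f xs = ereal \<Delta> \<and>
      (\<forall>k. x (Suc k) = x k - step_size l (norm (grad d f (x k))) *\<^sub>R grad d f (x k)) \<and>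
      \<epsilon> > 0 \<and>
      real T \<ge> l 0 * (norm (x 0 - xs))\<^sup>2 / \<epsilon>
        + min Tbar (l (2 * norm (grad d f (x 0))) * (norm (x 0 - xs))\<^sup>2 / (2 * \<epsilon>))"
    for d f xs x \<epsilon> T
  proof -
    let ?F = "\<lambda>y. real_of_ereal (f y)"
    interpret convex_generalized_smooth l "Rn d" "fin_dom d f" ?F "grad d f"
      "\<lambda>y. frechet_derivative (grad d f) (at y within fin_dom d f)"
      using H by (intro convex_generalized_smooth_if_l_smooth) auto
    have real: "f y = ereal (?F y)" if "y \<in> fin_dom d f" for y
      using that H by (auto simp: fin_dom_def ereal_real)
    have x0: "x 0 \<in> fin_dom d f" using H by blast
    have iter: "x (Suc k) = gd_step (x k)" for k using H by (simp add: gd_step_def)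
    have "f xs \<le> f (x 0)" using H by (auto simp: fin_dom_def)
    then have xs: "xs \<in> fin_dom d f" using H by (auto simp: fin_dom_def)
    have xT: "x T \<in> fin_dom d f" by (rule iterates_in_domain[OF x0 iter])
    have "f xs \<le> f (x T)" using H xT by (auto simp: fin_dom_def)
    then have min: "?F xs \<le> ?F (x T)" using real[OF xs] real[OF xT] by (metis ereal_less_eq(3))
    have "f (x 0) - f xs = ereal \<Delta>" using H by blast
    then have \<Delta>_eq: "?F (x 0) - ?F xs = \<Delta>"
      using real[OF x0] real[OF xs] by (metis ereal_minus(1) ereal.inject)
    have \<epsilon>: "\<epsilon> > 0" using H by blast
    let ?A = "l 0 * (norm (x 0 - xs))\<^sup>2 / \<epsilon>"
    let ?B = "l (2 * norm (grad d f (x 0))) * (norm (x 0 - xs))\<^sup>2 / (2 * \<epsilon>)"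
    have T: "?A + min Tbar ?B \<le> real T" using H by blast
    have A: "0 \<le> ?A" using l_pos[rule_format, of 0] \<epsilon> by simp
    have "?F (x T) - ?F xs \<le> \<epsilon>"
    proof (cases "Tbar \<le> ?B")
      case True
      then have "?A + 2 * (?F (x 0) - ?F xs) / (M\<^sup>2 / l (2 * M)) \<le> real T"
        using T by (simp add: \<Delta>_eq Tbar_def)
      then show ?thesis by (rule accuracy_from_threshold[OF x0 iter xs \<epsilon> M psi2 min])
    next
      case False
      then have "?B \<le> real T" using T A by simp
      then show ?thesis by (rule accuracy_from_initial_gradient[OF x0 iter xs \<epsilon>])
    qed
    then show ?thesis using real[OF xs] real[OF xT] by (metis ereal_minus(1) ereal_less_eq(3))
  qed
  ultimately show "\<exists>Tbar\<ge>0. \<forall>(d::nat) (f :: fin_seq \<Rightarrow> ereal) (xs :: fin_seq) (x :: nat \<Rightarrow> fin_seq) (\<epsilon>::real) (T::nat).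
      (\<forall>y\<in>Rn d. f y \<noteq> -\<infinity>) \<and>
      openin (top_of_set (Rn d)) (fin_dom d f) \<and> convex (fin_dom d f) \<and>
      l_smooth d l f \<and>
      convex_on (fin_dom d f) (\<lambda>y. real_of_ereal (f y)) \<and>
      xs \<in> Rn d \<and> (\<forall>y\<in>Rn d. f xs \<le> f y) \<and>
      x 0 \<in> fin_dom d f \<and> f (x 0) - f xs = ereal \<Delta> \<and>
      (\<forall>k. x (Suc k) = x k - step_size l (norm (grad d f (x k))) *\<^sub>R grad d f (x k)) \<and>
      \<epsilon> > 0 \<and>
      real T \<ge> l 0 * (norm (x 0 - xs))\<^sup>2 / \<epsilon>
        + min Tbar (l (2 * norm (grad d f (x 0))) * (norm (x 0 - xs))\<^sup>2 / (2 * \<epsilon>))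
      \<longrightarrow> f (x T) - f xs \<le> ereal \<epsilon>"
    by blast
qed

end
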